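(* Let $X$ be a strong PP-space, let $Y$ be a topological space, let $\{Z_n:n\in\mathbb N\}$ be a closed cover of a contractible perfectly normal space $Z$, suppose that $(Z,(Z_n)_{n=1}^\infty)$ has the property $( * )$, and suppose that $Z_n$ is weakly $B_1$-favorable for $X\times Y$ for every $n\in\mathbb N$. Then every vertically nearly separately continuous mapping $f:X\times Y\to Z$ is of the first Baire class, i.e. $$C\overline{C}(X\times Y,Z)\subseteq B_1(X\times Y,Z).$$
   Context: For topological spaces $S,T$, $C(S,T)$ is the set of continuous mappings $S\to T$, and $B_1(S,T)$ (first Baire class) is the set of mappings $S\to T$ that are pointwise limits of a sequence of mappings from $C(S,T)$. For $f:X\times Y\to Z$ write $f^x(y)=f_y(x)=f(x,y)$. The mapping $f$ is vertically nearly separately continuous, $f\in C\overline{C}(X\times Y,Z)$, if $f_y\in C(X,Z)$ for every $y\in Y$ and there is a dense set $D\subseteq X$ such that $f^x\in C(Y,Z)$ for all $x\in D$. A zero set (co-zero set) in a space $S$ is a set of the form $g^{-1}(0)$ (respectively $g^{-1}((0,1])$) with $g:S\to[0,1]$ continuous. A topological space $X$ is a strong PP-space if for every dense set $D\subseteq X$ there exist a sequence $((U_{i,n}:i\in I_n))_{n=1}^\infty$ of locally finite covers of $X$ by co-zero sets $U_{i,n}$ and a sequence $((x_{i,n}:i\in I_n))_{n=1}^\infty$ of families of points of $D$ such that for every $x\in X$ and every sequence of indices $i_n\in I_n$ with $x\in U_{i_n,n}$ for all $n\in\mathbb N$, one has $x_{i_n,n}\to x$. A space is perfectly normal if it is normal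 and each of its closed subsets is a $G_\delta$-set. A space $Z$ is contractible if there exist $z^*\in Z$ and a continuous function $\gamma:Z\times[0,1]\to Z$ such that $\gamma(z,0)=z$ and $\gamma(z,1)=z^*$ for all $z\in Z$. For a cover $\{Z_n:n\in\mathbb N\}$ of $Z$, $(Z,(Z_n)_{n=1}^\infty)$ has the property $( * )$ if for every convergent sequence $(z_k)_{k=1}^\infty$ in $Z$ there exists $n$ such that $\{z_k:k\in\mathbb N\}\subseteq Z_n$. $H_1^*(S,T)$ denotes the set of all mappings $g:S\to T$ such that for every open set $V\subseteq T$ the preimage $g^{-1}(V)$ is an $F_\sigma^*$-set in $S$, i.e. a countable union of zero sets of $S$. A space $T$ is weakly $B_1$-favorable for a space $S$ if $H_1^*(S,T)\subseteq B_1(S,T)$. The sets $Z_n$ carry the subspace topology. *)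

theory Defs
  imports "HOL-Analysis.Analysis"
begin

text \<open>Spaces are abstract topologies with carrier \<^term>\<open>topspace X\<close>. A mapping between spaces is a
  total HOL function that maps one carrier into the other; its values off the carrier play no role.\<close>

definition continuous_maps :: "'a topology \<Rightarrow> 'b topology \<Rightarrow> ('a \<Rightarrow> 'b) set" where
  "continuous_maps S T = {f. continuous_map S T f}"

definition baire_one :: "'a topology \<Rightarrow> 'b topology \<Rightarrow> ('a \<Rightarrow> 'b) set" where
  "baire_one S T = {f. f \<in> topspace S \<rightarrow> topspace T \<and>
     (\<exists>g :: nat \<Rightarrow> 'a \<Rightarrow> 'b. (\<forall>n. g n \<in> continuous_maps S T) \<and>
        (\<forall>p \<in> topspace S. limitin T (\<lambda>n. g n p) (f p) sequentially))}"

definition dense_in :: "'a topology \<Rightarrow> 'a set \<Rightarrow> bool" where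
  "dense_in X D \<longleftrightarrow> D \<subseteq> topspace X \<and> X closure_of D = topspace X"

definition vert_nearly_sep_continuous ::
  "'a topology \<Rightarrow> 'b topology \<Rightarrow> 'c topology \<Rightarrow> ('a \<times> 'b \<Rightarrow> 'c) set" where
  "vert_nearly_sep_continuous X Y Z =
     {f. f \<in> topspace (prod_topology X Y) \<rightarrow> topspace Z \<and>
         (\<forall>y \<in> topspace Y. (\<lambda>x. f (x, y)) \<in> continuous_maps X Z) \<and>
         (\<exists>D. dense_in X D \<and> (\<forall>x \<in> D. (\<lambda>y. f (x, y)) \<in> continuous_maps Y Z))}"

definition zero_set_in :: "'a topology \<Rightarrow> 'a set \<Rightarrow> bool" where
  "zero_set_in S A \<longleftrightarrow> (\<exists>g. continuous_map S (top_of_set {0..1::real}) g \<and>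
     A = {p \<in> topspace S. g p = 0})"

definition cozero_set_in :: "'a topology \<Rightarrow> 'a set \<Rightarrow> bool" where
  "cozero_set_in S A \<longleftrightarrow> (\<exists>g. continuous_map S (top_of_set {0..1::real}) g \<and>
     A = {p \<in> topspace S. g p \<in> {0<..1}})"

text \<open>Local finiteness of an indexed family counts indices; the library's \<^const>\<open>locally_finite_in\<close>
  concerns unindexed collections of sets.\<close>

definition locally_finite_cozero_cover :: "'a topology \<Rightarrow> 'i set \<Rightarrow> ('i \<Rightarrow> 'a set) \<Rightarrow> bool" where
  "locally_finite_cozero_cover X I U \<longleftrightarrow>
     (\<forall>i \<in> I. cozero_set_in X (U i)) \<and>
     (\<Union>i \<in> I. U i) = topspace X \<and>
     (\<forall>p \<in> topspace X. \<exists>V. openin X V \<and> p \<in> V \<and> finite {i \<in> I. U i \<inter> V \<noteq> {}})"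

definition strong_PP_system ::
  "'a topology \<Rightarrow> 'a set \<Rightarrow> (nat \<Rightarrow> 'i set) \<Rightarrow> (nat \<Rightarrow> 'i \<Rightarrow> 'a set) \<Rightarrow> (nat \<Rightarrow> 'i \<Rightarrow> 'a) \<Rightarrow> bool" where
  "strong_PP_system X D I U x \<longleftrightarrow>
     (\<forall>n. locally_finite_cozero_cover X (I n) (U n)) \<and>
     (\<forall>n. \<forall>i \<in> I n. x n i \<in> D) \<and>
     (\<forall>p \<in> topspace X. \<forall>j :: nat \<Rightarrow> 'i.
        (\<forall>n. j n \<in> I n \<and> p \<in> U n (j n)) \<longrightarrow> limitin X (\<lambda>n. x n (j n)) p sequentially)"

text \<open>The existential quantifier over index sets has to be over a fixed type. Pairs of a set and a
  point lose no generality: an index can be replaced by the pair of its set and its point. The lemma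
  after the definition makes this precise for an arbitrary index type.\<close>

definition strong_PP_space :: "'a topology \<Rightarrow> bool" where
  "strong_PP_space X \<longleftrightarrow>
     (\<forall>D. dense_in X D \<longrightarrow>
        (\<exists>(I :: nat \<Rightarrow> ('a set \<times> 'a) set) U x. strong_PP_system X D I U x))"

lemma strong_PP_system_index_type:
  fixes I :: "nat \<Rightarrow> 'i set" and X :: "'a topology"
  assumes "strong_PP_system X D I U x"
  shows "\<exists>(I' :: nat \<Rightarrow> ('a set \<times> 'a) set) U' x'. strong_PP_system X D I' U' x'"
proof -
  define I' where "I' n = (\<lambda>i. (U n i, x n i)) ` I n" for n
  have "locally_finite_cozero_cover X (I' n) fst" for n
  proof -
    have c: "locally_finite_cozero_cover X (I n) (U n)"
      using assms by (simp add: strong_PP_system_def)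
    have "{q \<in> I' n. fst q \<inter> V \<noteq> {}} = (\<lambda>i. (U n i, x n i)) ` {i \<in> I n. U n i \<inter> V \<noteq> {}}" for V
      by (force simp: I'_def image_iff)
    then have "finite {i \<in> I n. U n i \<inter> V \<noteq> {}} \<Longrightarrow> finite {q \<in> I' n. fst q \<inter> V \<noteq> {}}" for V
      by simp
    moreover have "(\<Union>q \<in> I' n. fst q) = (\<Union>i \<in> I n. U n i)"
      by (simp add: I'_def)
    moreover have "\<forall>q \<in> I' n. cozero_set_in X (fst q)"
      using c by (auto simp: I'_def locally_finite_cozero_cover_def)
    ultimately show ?thesis
      using c unfolding locally_finite_cozero_cover_def by (intro conjI) (simp_all, blast)
  qed
  moreover have "\<forall>n. \<forall>q \<in> I' n. snd q \<in> D"
    using assms by (auto simp: I'_def strong_PP_system_def)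
  moreover have "limitin X (\<lambda>n. snd (j n)) p sequentially"
    if p: "p \<in> topspace X" and j: "\<forall>n. j n \<in> I' n \<and> p \<in> fst (j n)" for p j
  proof -
    have "\<forall>n. \<exists>i. i \<in> I n \<and> j n = (U n i, x n i)"
      using j by (auto simp: I'_def)
    then obtain k where k: "\<And>n. k n \<in> I n \<and> j n = (U n (k n), x n (k n))"
      by metis
    then have "\<forall>n. k n \<in> I n \<and> p \<in> U n (k n)"
      using j by (metis fst_conv)
    then have "limitin X (\<lambda>n. x n (k n)) p sequentially"
      using assms p by (simp add: strong_PP_system_def)
    then show ?thesis
      using k by simp
  qed
  ultimately have "strong_PP_system X D I' (\<lambda>_. fst) (\<lambda>_. snd)"
    by (simp add: strong_PP_system_def)
  then show ?thesis
    by blast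
qed

text \<open>No \<open>T\<^sub>1\<close> axiom is part of normality here.\<close>

definition perfectly_normal_space :: "'a topology \<Rightarrow> bool" where
  "perfectly_normal_space X \<longleftrightarrow> normal_space X \<and> (\<forall>A. closedin X A \<longrightarrow> gdelta_in X A)"

definition convergent_sequence_absorbing :: "'a topology \<Rightarrow> (nat \<Rightarrow> 'a set) \<Rightarrow> bool" where
  "convergent_sequence_absorbing Z Zs \<longleftrightarrow>
     (\<forall>z :: nat \<Rightarrow> 'a. range z \<subseteq> topspace Z \<and> (\<exists>l. limitin Z z l sequentially) \<longrightarrow>
        (\<exists>n. range z \<subseteq> Zs n))"

definition H1_star :: "'a topology \<Rightarrow> 'b topology \<Rightarrow> ('a \<Rightarrow> 'b) set" where
  "H1_star S T = {g. g \<in> topspace S \<rightarrow> topspace T \<and>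
     (\<forall>V. openin T V \<longrightarrow> (countable union_of zero_set_in S) {p \<in> topspace S. g p \<in> V})}"

definition weakly_B1_favorable :: "'b topology \<Rightarrow> 'a topology \<Rightarrow> bool" where
  "weakly_B1_favorable T S \<longleftrightarrow> H1_star S T \<subseteq> baire_one S T"

end

theory Submission
  imports Defs
begin

text \<open>The approximants \<open>f (\<xi> n i, y)\<close>, with \<open>i\<close> such that \<open>x \<in> U n i\<close>, converge to \<open>f (x, y)\<close> for every
  choice of the indices. For closed \<open>F \<subseteq> Z\<close> the points \<open>(x, y)\<close> at which all approximants of stage
  \<open>n\<close> lie in \<open>F\<close> form a zero set; exhausting an open set by closed sets, one gets that preimages
  of open sets under \<open>f\<close> are countable unions of zero sets. By the property \<open>(*)\<close> the zero sets
  \<open>G m\<close> of points all of whose approximants lie in \<open>Zs m\<close> cover the product. On \<open>G m\<close> the mapping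
  \<open>f\<close> takes values in \<open>Zs m\<close>, and making it constant off \<open>G m\<close> gives a mapping to which
  favorability of \<open>Zs m\<close> applies. The resulting approximating sequences are glued along disjoint
  zero sets by means of the contraction of \<open>Z\<close>.\<close>

section \<open>Zero sets\<close>

text \<open>Truncating \<open>\<bar>g p\<bar>\<close> at 1 keeps the zeros and forces values in the
  unit interval, so any continuous real function may be used to produce zero sets.\<close>

lemma zero_set_in_zeros:
  assumes "continuous_map S euclideanreal g"
  shows "zero_set_in S {p \<in> topspace S. g p = 0}"
  unfolding zero_set_in_def
proof (intro exI conjI)
  show "continuous_map S (top_of_set {0..1}) (\<lambda>p. min 1 \<bar>g p\<bar>)"
    using assms by (auto simp: continuous_map_in_subtopology intro!: continuous_intros)
  show "{p \<in> topspace S. g p = 0} = {p \<in> topspace S. min 1 \<bar>g p\<bar> = 0}"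
    by (auto simp: min_def)
qed

lemma zero_set_in_iff:
  "zero_set_in S A \<longleftrightarrow> (\<exists>g. continuous_map S euclideanreal g \<and>
     (\<forall>p \<in> topspace S. 0 \<le> g p \<and> g p \<le> 1) \<and> A = {p \<in> topspace S. g p = 0})"
proof
  assume "zero_set_in S A"
  then show "\<exists>g. continuous_map S euclideanreal g \<and>
     (\<forall>p \<in> topspace S. 0 \<le> g p \<and> g p \<le> 1) \<and> A = {p \<in> topspace S. g p = 0}"
    by (auto simp: zero_set_in_def continuous_map_in_subtopology Pi_iff)
qed (auto intro: zero_set_in_zeros)

lemma zero_set_inE:
  assumes "zero_set_in S A"
  obtains g where "continuous_map S euclideanreal g" "\<And>p. p \<in> topspace S \<Longrightarrow> 0 \<le> g p \<and> g p \<le> 1"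
    "A = {p \<in> topspace S. g p = 0}"
  using assms by (auto simp: zero_set_in_iff)

lemma zero_set_in_le:
  assumes "continuous_map S euclideanreal g"
  shows "zero_set_in S {p \<in> topspace S. g p \<le> c}"
proof -
  have "zero_set_in S {p \<in> topspace S. max 0 (g p - c) = 0}"
    using assms by (intro zero_set_in_zeros continuous_intros) auto
  moreover have "{p \<in> topspace S. max 0 (g p - c) = 0} = {p \<in> topspace S. g p \<le> c}"
    by auto
  ultimately show ?thesis
    by simp
qed

lemma zero_set_in_ge:
  assumes "continuous_map S euclideanreal g"
  shows "zero_set_in S {p \<in> topspace S. c \<le> g p}"
  using zero_set_in_le[of S "\<lambda>p. - g p" "- c"] assms by (simp add: continuous_intros)

lemma zero_set_in_subset: "zero_set_in S A \<Longrightarrow> A \<subseteq> topspace S"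
  by (auto simp: zero_set_in_def)

lemma zero_set_in_empty: "zero_set_in S {}"
  using zero_set_in_zeros[of S "\<lambda>_. 1"] by simp

lemma zero_set_in_Int:
  assumes "zero_set_in S A" "zero_set_in S B"
  shows "zero_set_in S (A \<inter> B)"
proof -
  obtain g where g: "continuous_map S euclideanreal g" "\<And>p. p \<in> topspace S \<Longrightarrow> 0 \<le> g p \<and> g p \<le> 1"
      "A = {p \<in> topspace S. g p = 0}"
    using assms(1) by (rule zero_set_inE) blast
  obtain h where h: "continuous_map S euclideanreal h" "\<And>p. p \<in> topspace S \<Longrightarrow> 0 \<le> h p \<and> h p \<le> 1"
      "B = {p \<in> topspace S. h p = 0}"
    using assms(2) by (rule zero_set_inE) blast
  have "zero_set_in S {p \<in> topspace S. g p + h p = 0}"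
    using g h by (intro zero_set_in_zeros continuous_intros)
  moreover have "{p \<in> topspace S. g p + h p = 0} = A \<inter> B"
    using g h by (force simp: add_nonneg_eq_0_iff)
  ultimately show ?thesis
    by simp
qed

lemma zero_set_in_Un:
  assumes "zero_set_in S A" "zero_set_in S B"
  shows "zero_set_in S (A \<union> B)"
proof -
  obtain g where g: "continuous_map S euclideanreal g" "A = {p \<in> topspace S. g p = 0}"
    using zero_set_inE[OF assms(1)] by blast
  obtain h where h: "continuous_map S euclideanreal h" "B = {p \<in> topspace S. h p = 0}"
    using zero_set_inE[OF assms(2)] by blast
  have "zero_set_in S {p \<in> topspace S. g p * h p = 0}"
    using g h by (intro zero_set_in_zeros continuous_intros)
  moreover have "{p \<in> topspace S. g p * h p = 0} = A \<union> B"
    using g h by auto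
  ultimately show ?thesis
    by simp
qed

lemma zero_set_in_finite_UN:
  assumes "finite K" "\<And>k. k \<in> K \<Longrightarrow> zero_set_in S (A k)"
  shows "zero_set_in S (\<Union>k \<in> K. A k)"
  using assms by (induction K) (auto simp: zero_set_in_empty zero_set_in_Un)

text \<open>If \<open>g n\<close> defines \<open>A n\<close>, the series of the \<open>g n\<close>
  with weights \<open>(1/2)^n\<close> converges uniformly, hence has a continuous sum; as its terms
  are nonnegative, the sum vanishes exactly where all of them do.\<close>

lemma zero_set_in_INT:
  assumes "\<And>n::nat. zero_set_in S (A n)"
  shows "zero_set_in S (\<Inter>n. A n)"
proof -
  have "\<forall>n. \<exists>g. continuous_map S euclideanreal g \<and> (\<forall>p \<in> topspace S. 0 \<le> g p \<and> g p \<le> 1) \<and>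
          A n = {p \<in> topspace S. g p = 0}"
    using assms by (simp add: zero_set_in_iff)
  from choice[OF this] obtain g where g: "\<And>n. continuous_map S euclideanreal (g n)"
      "\<And>n p. p \<in> topspace S \<Longrightarrow> 0 \<le> g n p \<and> g n p \<le> 1"
      "\<And>n. A n = {p \<in> topspace S. g n p = 0}"
    by blast
  define h where "h p = (\<Sum>n. (1/2)^n * g n p)" for p
  have bound: "norm ((1/2)^n * g n p) \<le> (1/2)^n" if "p \<in> topspace S" for n p
    using g(2)[OF that, of n] by (simp add: mult_left_le)
  have summ: "summable (\<lambda>n. (1/2)^n * g n p)" if "p \<in> topspace S" for p
    by (rule summable_comparison_test'[of "\<lambda>n. (1/2)^n" 0]) (use bound that in auto)
  have "uniform_limit (topspace S) (\<lambda>N p. \<Sum>n<N. (1/2)^n * g n p) h sequentially"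
    unfolding h_def by (rule Weierstrass_m_test[of _ _ "\<lambda>n. (1/2)^n"]) (use bound in auto)
  moreover have "continuous_map S euclideanreal (\<lambda>p. \<Sum>n<N. (1/2)^n * g n p)" for N
    by (intro continuous_intros g) auto
  ultimately have "continuous_map S euclideanreal h"
    using Met_TC.continuous_map_uniform_limit[of S "\<lambda>N p. \<Sum>n<N. (1/2)^n * g n p" sequentially h]
    by (simp add: uniform_limit_iff)
  then have "zero_set_in S {p \<in> topspace S. h p = 0}"
    by (rule zero_set_in_zeros)
  moreover have "h p = 0 \<longleftrightarrow> (\<forall>n. g n p = 0)" if "p \<in> topspace S" for p
    using suminf_eq_zero_iff[OF summ[OF that]] g(2)[OF that] by (simp add: h_def)
  then have "{p \<in> topspace S. h p = 0} = (\<Inter>n. A n)"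
    using g(3) by auto
  ultimately show ?thesis
    by simp
qed

section \<open>Co-zero sets and their locally finite unions\<close>

lemma cozero_set_in_positive:
  assumes "cozero_set_in S A"
  shows "\<exists>g. continuous_map S euclideanreal g \<and> (\<forall>p \<in> topspace S. 0 \<le> g p) \<and>
    A = {p \<in> topspace S. g p > 0}"
proof -
  obtain g where g: "continuous_map S euclideanreal g" "\<And>p. p \<in> topspace S \<Longrightarrow> 0 \<le> g p \<and> g p \<le> 1"
    "A = {p \<in> topspace S. g p \<in> {0<..1}}"
    using assms by (auto simp: cozero_set_in_def continuous_map_in_subtopology Pi_iff)
  then show ?thesis
    by (intro exI[of _ g]) auto
qed

lemma cozero_set_in_iff: "cozero_set_in S A \<longleftrightarrow> A \<subseteq> topspace S \<and> zero_set_in S (topspace S - A)"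
proof
  assume "cozero_set_in S A"
  then obtain g where g: "continuous_map S euclideanreal g" "\<And>p. p \<in> topspace S \<Longrightarrow> 0 \<le> g p"
    "A = {p \<in> topspace S. g p > 0}"
    using cozero_set_in_positive by blast
  moreover have "topspace S - A = {p \<in> topspace S. g p \<le> 0}"
    using g by auto
  ultimately show "A \<subseteq> topspace S \<and> zero_set_in S (topspace S - A)"
    using zero_set_in_le[of S g 0] by auto
next
  assume A: "A \<subseteq> topspace S \<and> zero_set_in S (topspace S - A)"
  then obtain g where "continuous_map S (top_of_set {0..1::real}) g"
      "topspace S - A = {p \<in> topspace S. g p = 0}"
    by (auto simp: zero_set_in_def)
  moreover from this have "A = {p \<in> topspace S. g p \<in> {0<..1}}"
    using A by (force simp: continuous_map_in_subtopology Pi_iff less_le)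
  ultimately show "cozero_set_in S A"
    unfolding cozero_set_in_def by blast
qed

text \<open>The set where \<open>g\<close> is positive is exhausted by the sets where
  \<open>g\<close> is at least \<open>1 / real (Suc n)\<close>.\<close>

lemma cozero_set_in_countable_union_of_zero_set_in:
  assumes "cozero_set_in S A"
  shows "(countable union_of zero_set_in S) A"
proof -
  obtain g where g: "continuous_map S euclideanreal g" "A = {p \<in> topspace S. g p > 0}"
    using cozero_set_in_positive[OF assms] by blast
  have "A = (\<Union>n::nat. {p \<in> topspace S. 1 / real (Suc n) \<le> g p})"
  proof (intro equalityI subsetI)
    fix p assume "p \<in> A"
    then show "p \<in> (\<Union>n::nat. {p \<in> topspace S. 1 / real (Suc n) \<le> g p})"
      using nat_approx_posE[of "g p"] by (simp add: g) (meson less_imp_le)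
  next
    fix p assume "p \<in> (\<Union>n::nat. {p \<in> topspace S. 1 / real (Suc n) \<le> g p})"
    then obtain n where "p \<in> topspace S" "1 / real (Suc n) \<le> g p"
      by blast
    moreover have "0 < 1 / real (Suc n)"
      by simp
    ultimately have "0 < g p"
      by linarith
    with \<open>p \<in> topspace S\<close> show "p \<in> A"
      by (simp add: g)
  qed
  also have "(countable union_of zero_set_in S) \<dots>"
    by (intro countable_union_of_UN countable_union_of_inc zero_set_in_ge g) simp
  finally show ?thesis .
qed

text \<open>Summing over the indices with nonzero value keeps the index set finite at each point.
  Near a point the sum agrees with a sum over one fixed finite set, so continuity follows by pasting
  over neighbourhoods.\<close>

lemma continuous_map_locally_finite_sum:
  fixes g :: "'i \<Rightarrow> 'a \<Rightarrow> real"
  assumes cont: "\<And>i. i \<in> I \<Longrightarrow> continuous_map S euclideanreal (g i)"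
    and fin: "\<And>p. p \<in> topspace S \<Longrightarrow>
      \<exists>V. openin S V \<and> p \<in> V \<and> finite {i \<in> I. \<exists>q \<in> V. g i q \<noteq> 0}"
  shows "continuous_map S euclideanreal (\<lambda>p. \<Sum>i | i \<in> I \<and> g i p \<noteq> 0. g i p)"
proof -
  have "\<forall>p \<in> topspace S. \<exists>V. openin S V \<and> p \<in> V \<and> finite {i \<in> I. \<exists>q \<in> V. g i q \<noteq> 0}"
    using fin by blast
  from bchoice[OF this] obtain V where V: "\<And>p. p \<in> topspace S \<Longrightarrow>
      openin S (V p) \<and> p \<in> V p \<and> finite {i \<in> I. \<exists>q \<in> V p. g i q \<noteq> 0}"
    by blast
  \<comment> \<open>The finite set that serves all points of \<open>V p\<close> at once; the terms
    it adds to the sum are zero.\<close>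
  define F where "F p = {i \<in> I. \<exists>q \<in> V p. g i q \<noteq> 0}" for p
  have eq: "(\<Sum>i | i \<in> I \<and> g i q \<noteq> 0. g i q) = (\<Sum>i \<in> F p. g i q)"
    if "p \<in> topspace S" "q \<in> V p" for p q
    using V[OF that(1)] that by (intro sum.mono_neutral_left) (auto simp: F_def)
  show ?thesis
  proof (rule pasting_lemma[where I = "topspace S" and T = V and f = "\<lambda>p q. \<Sum>i \<in> F p. g i q"])
    fix p assume "p \<in> topspace S"
    then show "openin S (V p)"
      "\<exists>j. j \<in> topspace S \<and> p \<in> V j \<and> (\<Sum>i | i \<in> I \<and> g i p \<noteq> 0. g i p) = (\<Sum>i \<in> F j. g i p)"
      "continuous_map (subtopology S (V p)) euclideanreal (\<lambda>q. \<Sum>i \<in> F p. g i q)"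
      using V[of p] eq[of p p]
      by (auto simp: F_def intro!: continuous_map_from_subtopology cont continuous_map_sum)
  next
    fix p q r assume "p \<in> topspace S" "q \<in> topspace S" "r \<in> topspace S \<inter> V p \<inter> V q"
    then show "(\<Sum>i \<in> F p. g i r) = (\<Sum>i \<in> F q. g i r)"
      using eq[of p r] eq[of q r] by simp
  qed
qed

text \<open>The sum of nonnegative functions defining the \<open>W i\<close> is continuous by local
  finiteness, and it is nonzero exactly on the union.\<close>

lemma cozero_set_in_locally_finite_UN:
  assumes coz: "\<And>i. i \<in> I \<Longrightarrow> cozero_set_in S (W i)"
    and fin: "\<And>p. p \<in> topspace S \<Longrightarrow> \<exists>V. openin S V \<and> p \<in> V \<and> finite {i \<in> I. W i \<inter> V \<noteq> {}}"
  shows "cozero_set_in S (\<Union>i \<in> I. W i)"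
proof -
  have "\<exists>g. continuous_map S euclideanreal g \<and> (\<forall>p \<in> topspace S. 0 \<le> g p) \<and>
          W i = {p \<in> topspace S. g p > 0}" if "i \<in> I" for i
    by (intro cozero_set_in_positive coz that)
  then obtain g where g: "\<And>i. i \<in> I \<Longrightarrow> continuous_map S euclideanreal (g i)"
      "\<And>i p. i \<in> I \<Longrightarrow> p \<in> topspace S \<Longrightarrow> 0 \<le> g i p"
      "\<And>i. i \<in> I \<Longrightarrow> W i = {p \<in> topspace S. g i p > 0}"
    by metis
  define h where "h p = (\<Sum>i | i \<in> I \<and> g i p \<noteq> 0. g i p)" for p
  have nz: "g i p \<noteq> 0 \<longleftrightarrow> p \<in> W i" if "i \<in> I" "p \<in> topspace S" for i p
    using g(2,3)[OF that(1)] that by force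
  have fin': "\<exists>V. openin S V \<and> p \<in> V \<and> finite {i \<in> I. \<exists>q \<in> V. g i q \<noteq> 0}" if p: "p \<in> topspace S" for p
  proof -
    obtain V where V: "openin S V" "p \<in> V" "finite {i \<in> I. W i \<inter> V \<noteq> {}}"
      using fin[OF p] by blast
    have "{i \<in> I. \<exists>q \<in> V. g i q \<noteq> 0} \<subseteq> {i \<in> I. W i \<inter> V \<noteq> {}}"
      using nz openin_subset[OF V(1)] by blast
    then show ?thesis
      using V finite_subset by blast
  qed
  have "continuous_map S euclideanreal h"
    unfolding h_def by (intro continuous_map_locally_finite_sum g fin')
  then have "zero_set_in S {p \<in> topspace S. h p = 0}"
    by (rule zero_set_in_zeros)
  moreover have "h p = 0 \<longleftrightarrow> p \<notin> (\<Union>i \<in> I. W i)" if p: "p \<in> topspace S" for p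
  proof -
    have "finite {i \<in> I. g i p \<noteq> 0}"
    proof -
      obtain V where "p \<in> V" "finite {i \<in> I. \<exists>q \<in> V. g i q \<noteq> 0}"
        using fin'[OF p] by blast
      then show ?thesis
        by (elim finite_subset[rotated]) blast
    qed
    then have "h p = 0 \<longleftrightarrow> (\<forall>i \<in> {i \<in> I. g i p \<noteq> 0}. g i p = 0)"
      unfolding h_def by (intro sum_nonneg_eq_0_iff) (use g(2) p in auto)
    then show ?thesis
      using nz p by auto
  qed
  then have "{p \<in> topspace S. h p = 0} = topspace S - (\<Union>i \<in> I. W i)"
    by blast
  moreover have "(\<Union>i \<in> I. W i) \<subseteq> topspace S"
    using g(3) by blast
  ultimately show ?thesis
    by (simp add: cozero_set_in_iff)
qed

section \<open>Preimages and products, and closed sets in perfectly normal spaces\<close>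

lemma zero_set_in_preimage:
  assumes "continuous_map S T f" "zero_set_in T A"
  shows "zero_set_in S {p \<in> topspace S. f p \<in> A}"
proof -
  obtain g where g: "continuous_map T euclideanreal g" "A = {p \<in> topspace T. g p = 0}"
    using zero_set_inE[OF assms(2)] by blast
  have "zero_set_in S {p \<in> topspace S. (g \<circ> f) p = 0}"
    using assms(1) g(1) by (intro zero_set_in_zeros continuous_map_compose)
  moreover have "{p \<in> topspace S. (g \<circ> f) p = 0} = {p \<in> topspace S. f p \<in> A}"
    using continuous_map_funspace[OF assms(1)] g(2) by auto
  ultimately show ?thesis
    by simp
qed

lemma cozero_set_in_preimage:
  assumes "continuous_map S T f" "cozero_set_in T A"
  shows "cozero_set_in S {p \<in> topspace S. f p \<in> A}"
proof -
  have "{p \<in> topspace S. f p \<in> topspace T - A} = topspace S - {p \<in> topspace S. f p \<in> A}"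
    using continuous_map_funspace[OF assms(1)] by auto
  moreover have "zero_set_in S {p \<in> topspace S. f p \<in> topspace T - A}"
    using assms by (intro zero_set_in_preimage[OF assms(1)]) (simp add: cozero_set_in_iff)
  ultimately show ?thesis
    by (simp add: cozero_set_in_iff)
qed

lemma cozero_set_in_Int:
  assumes "cozero_set_in S A" "cozero_set_in S B"
  shows "cozero_set_in S (A \<inter> B)"
  using assms zero_set_in_Un[of S "topspace S - A" "topspace S - B"]
  by (auto simp: cozero_set_in_iff Diff_Int)

lemma cozero_set_in_Times:
  assumes "cozero_set_in S A" "cozero_set_in T B"
  shows "cozero_set_in (prod_topology S T) (A \<times> B)"
proof -
  have "cozero_set_in (prod_topology S T) ({p \<in> topspace (prod_topology S T). fst p \<in> A} \<inter>
      {p \<in> topspace (prod_topology S T). snd p \<in> B})"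
    by (intro cozero_set_in_Int cozero_set_in_preimage[OF _ assms(1)]
      cozero_set_in_preimage[OF _ assms(2)] continuous_map_fst continuous_map_snd)
  moreover have "{p \<in> topspace (prod_topology S T). fst p \<in> A} \<inter>
      {p \<in> topspace (prod_topology S T). snd p \<in> B} = A \<times> B"
    using assms by (auto simp: cozero_set_in_iff)
  ultimately show ?thesis
    by simp
qed

text \<open>Write \<open>A\<close> as a countable intersection of open sets \<open>U n\<close>.
  Urysohn's lemma inserts a zero set between \<open>A\<close> and each \<open>U n\<close>, and the
  intersection of these zero sets is \<open>A\<close>.\<close>

lemma perfectly_normal_closedin_zero_set_in:
  assumes "perfectly_normal_space Z" "closedin Z A"
  shows "zero_set_in Z A"
proof -
  have A: "A \<subseteq> topspace Z"
    using assms(2) closedin_subset by blast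
  have "(countable intersection_of openin Z) A"
    using assms by (auto simp: perfectly_normal_space_def gdelta_in_alt)
  then obtain \<U> where \<U>: "countable \<U>" "\<And>U. U \<in> \<U> \<Longrightarrow> openin Z U" "\<Inter>\<U> = A"
    by (auto simp: intersection_of_def)
  \<comment> \<open>Inserting the carrier makes the family nonempty, so that it can be enumerated;
    the intersection stays \<open>A\<close>.\<close>
  define U where "U = from_nat_into (insert (topspace Z) \<U>)"
  have rU: "range U = insert (topspace Z) \<U>"
    unfolding U_def using \<U>(1) by (intro range_from_nat_into) auto
  have U: "openin Z (U n)" "A \<subseteq> U n" for n
  proof -
    have "U n \<in> insert (topspace Z) \<U>"
      using rU by blast
    then show "openin Z (U n)" "A \<subseteq> U n"
      using \<U> A by auto
  qed
  have "\<exists>B. zero_set_in Z B \<and> A \<subseteq> B \<and> B \<subseteq> U n" for n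
  proof -
    obtain g :: "'a \<Rightarrow> real" where g: "continuous_map Z (top_of_set {0..1}) g"
        "g ` A \<subseteq> {0}" "g ` (topspace Z - U n) \<subseteq> {1}"
      using Urysohn_lemma[of Z A "topspace Z - U n" 0 1] assms U[of n]
      by (auto simp: perfectly_normal_space_def disjnt_def)
    have "zero_set_in Z {p \<in> topspace Z. g p = 0}"
      using g(1) by (intro zero_set_in_zeros) (auto simp: continuous_map_in_subtopology)
    moreover have "A \<subseteq> {p \<in> topspace Z. g p = 0}" "{p \<in> topspace Z. g p = 0} \<subseteq> U n"
      using A g(2,3) by (fastforce simp: image_subset_iff)+
    ultimately show ?thesis
      by blast
  qed
  then obtain B where B: "\<And>n. zero_set_in Z (B n)" "\<And>n. A \<subseteq> B n" "\<And>n. B n \<subseteq> U n"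
    by metis
  have "\<Inter>(range U) = A"
    using rU \<U>(3) A by auto
  then have "(\<Inter>n. B n) = A"
    using B(2,3) by blast
  then show ?thesis
    using zero_set_in_INT[of Z B, OF B(1)] by simp
qed

section \<open>Gluing along zero sets\<close>

text \<open>Unpacks the homotopy from the identity to a constant, with the factors of the product
  swapped. Nonemptiness of \<open>Z\<close> ensures that the constant \<open>a\<close> lies in the
  carrier.\<close>

lemma contractible_spaceE:
  assumes "contractible_space Z" "topspace Z \<noteq> {}"
  obtains a \<gamma> where "a \<in> topspace Z"
    "continuous_map (prod_topology Z (top_of_set {0..1::real})) Z \<gamma>"
    "\<And>z. \<gamma> (z, 0) = z" "\<And>z. \<gamma> (z, 1) = a"
proof -
  obtain a h where h: "continuous_map (prod_topology (top_of_set {0..1::real}) Z) Z h"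
      "\<And>z. h (0, z) = z" "\<And>z. h (1, z) = a"
    using assms(1) by (auto simp: contractible_space_def homotopic_with_def)
  show thesis
  proof
    show "continuous_map (prod_topology Z (top_of_set {0..1::real})) Z (h \<circ> (\<lambda>q. (snd q, fst q)))"
      by (rule continuous_map_compose[OF _ h(1)])
        (simp add: continuous_map_pairwise o_def continuous_map_fst continuous_map_snd)
    obtain z where "z \<in> topspace Z"
      using assms(2) by blast
    then have "h (1, z) \<in> topspace Z"
      using continuous_map_funspace[OF h(1)] by auto
    then show "a \<in> topspace Z"
      using h(3) by simp
  qed (use h in auto)
qed

text \<open>A function \<open>\<phi>\<close> with value 0 on \<open>A\<close> and 1 on
  \<open>B\<close> serves as time: up to 1/2 the values of \<open>f\<close> are contracted to the
  point \<open>a\<close>, afterwards the contraction is run backwards from \<open>a\<close> to the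
  values of \<open>g\<close>.\<close>

lemma contractible_glue_two:
  assumes Z: "contractible_space Z" "topspace Z \<noteq> {}"
    and A: "zero_set_in S A" and B: "zero_set_in S B" and disj: "A \<inter> B = {}"
    and f: "continuous_map S Z f" and g: "continuous_map S Z g"
  obtains h where "continuous_map S Z h" "\<And>p. p \<in> A \<Longrightarrow> h p = f p" "\<And>p. p \<in> B \<Longrightarrow> h p = g p"
proof -
  obtain a \<gamma> where \<gamma>: "a \<in> topspace Z" "continuous_map (prod_topology Z (top_of_set {0..1::real})) Z \<gamma>"
      "\<And>z. \<gamma> (z, 0) = z" "\<And>z. \<gamma> (z, 1) = a"
    using contractible_spaceE[OF Z] by blast
  obtain u where u: "continuous_map S euclideanreal u" "\<And>p. p \<in> topspace S \<Longrightarrow> 0 \<le> u p \<and> u p \<le> 1"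
      "A = {p \<in> topspace S. u p = 0}"
    using A by (rule zero_set_inE) blast
  obtain v where v: "continuous_map S euclideanreal v" "\<And>p. p \<in> topspace S \<Longrightarrow> 0 \<le> v p \<and> v p \<le> 1"
      "B = {p \<in> topspace S. v p = 0}"
    using B by (rule zero_set_inE) blast
  \<comment> \<open>Disjointness of \<open>A\<close> and \<open>B\<close> says that \<open>u\<close>
    and \<open>v\<close> have no common zero; this makes the quotient \<open>\<phi>\<close>
    continuous.\<close>
  have pos: "u p + v p > 0" if "p \<in> topspace S" for p
    using u(2)[OF that] v(2)[OF that] disj that unfolding u(3) v(3) by force
  define \<phi> where "\<phi> p = u p / (u p + v p)" for p
  have \<phi>: "continuous_map S euclideanreal \<phi>"
    unfolding \<phi>_def using u(1) v(1) pos by (intro continuous_intros) force+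
  have \<phi>01: "0 \<le> \<phi> p" "\<phi> p \<le> 1" if "p \<in> topspace S" for p
    using u(2)[OF that] v(2)[OF that] pos[OF that] by (auto simp: \<phi>_def)
  define h where "h p = (if \<phi> p \<le> 1/2 then \<gamma> (f p, 2 * \<phi> p) else \<gamma> (g p, 2 - 2 * \<phi> p))" for p
  have comp: "continuous_map (subtopology S C) Z (\<lambda>p. \<gamma> (k p, \<psi> p))"
    if "continuous_map S Z k" "continuous_map S euclideanreal \<psi>" "\<And>p. p \<in> topspace S \<inter> C \<Longrightarrow> \<psi> p \<in> {0..1}"
    for C k \<psi>
  proof -
    have "continuous_map (subtopology S C) (prod_topology Z (top_of_set {0..1::real})) (\<lambda>p. (k p, \<psi> p))"
      using that by (auto simp: continuous_map_pairwise o_def continuous_map_in_subtopology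
          intro: continuous_map_from_subtopology)
    from continuous_map_compose[OF this \<gamma>(2)] show ?thesis
      by (simp add: o_def)
  qed
  show thesis
  proof
    show "continuous_map S Z h"
      unfolding h_def
    proof (rule continuous_map_cases_le)
      show "continuous_map (subtopology S {p \<in> topspace S. \<phi> p \<le> 1/2}) Z (\<lambda>p. \<gamma> (f p, 2 * \<phi> p))"
        by (rule comp[OF f]) (use \<phi> \<phi>01 in \<open>auto intro!: continuous_intros\<close>)
      show "continuous_map (subtopology S {p \<in> topspace S. 1/2 \<le> \<phi> p}) Z (\<lambda>p. \<gamma> (g p, 2 - 2 * \<phi> p))"
        by (rule comp[OF g]) (use \<phi> \<phi>01 in \<open>auto intro!: continuous_intros\<close>)
      \<comment> \<open>At the switching time both branches sit at the contraction point.\<close>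
      show "\<gamma> (f p, 2 * \<phi> p) = \<gamma> (g p, 2 - 2 * \<phi> p)" if "\<phi> p = 1/2" for p
      proof -
        have "2 * \<phi> p = 1" "2 - 2 * \<phi> p = 1"
          using that by simp_all
        then show ?thesis
          by (simp only: \<gamma>(4))
      qed
    qed (use \<phi> in auto)
    show "h p = f p" if "p \<in> A" for p
      using that u(3) by (simp add: h_def \<phi>_def \<gamma>(3))
    show "h p = g p" if "p \<in> B" for p
    proof -
      have "\<phi> p = 1"
        using that v(3) pos[of p] by (simp add: \<phi>_def)
      then show ?thesis
        by (simp add: h_def \<gamma>(3))
    qed
  qed
qed

text \<open>By induction: the union of the first \<open>n\<close> sets is again a zero set disjoint
  from \<open>A n\<close>, so the map glued so far and \<open>g n\<close> can be glued as a
  pair.\<close>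

lemma contractible_glue_finite:
  fixes A :: "nat \<Rightarrow> 'a set"
  assumes Z: "contractible_space Z" "topspace Z \<noteq> {}"
    and A: "\<And>k. k < n \<Longrightarrow> zero_set_in S (A k)"
    and disj: "\<And>k l. k < l \<Longrightarrow> l < n \<Longrightarrow> A k \<inter> A l = {}"
    and g: "\<And>k. k < n \<Longrightarrow> continuous_map S Z (g k)"
  shows "\<exists>h. continuous_map S Z h \<and> (\<forall>k<n. \<forall>p \<in> A k. h p = g k p)"
  using A disj g
proof (induction n)
  case 0
  obtain z where "z \<in> topspace Z"
    using Z(2) by blast
  then have "continuous_map S Z (\<lambda>_. z)"
    by simp
  then show ?case
    by blast
next
  case (Suc n)
  obtain h where h: "continuous_map S Z h" "\<forall>k<n. \<forall>p \<in> A k. h p = g k p"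
    using Suc by (metis less_Suc_eq)
  have "zero_set_in S (\<Union>k<n. A k)"
    using Suc.prems(1) by (intro zero_set_in_finite_UN) auto
  moreover have "(\<Union>k<n. A k) \<inter> A n = {}"
    using Suc.prems(2) by blast
  ultimately obtain h' where "continuous_map S Z h'" "\<And>p. p \<in> (\<Union>k<n. A k) \<Longrightarrow> h' p = h p"
      "\<And>p. p \<in> A n \<Longrightarrow> h' p = g n p"
    using contractible_glue_two[OF Z _ Suc.prems(1)[of n] _ h(1) Suc.prems(3)[of n]] by blast
  with h(2) have "\<forall>k<Suc n. \<forall>p \<in> A k. h' p = g k p"
    by (metis UN_I lessThan_iff less_Suc_eq)
  with \<open>continuous_map S Z h'\<close> show ?case
    by blast
qed

text \<open>The differences of \<open>G m\<close> and the earlier \<open>G k\<close> partition the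
  carrier but need not be zero sets. Each is exhausted by zero sets \<open>A n m\<close>, disjoint
  for fixed \<open>n\<close>, and the \<open>n\<close>-th approximant glues the maps
  \<open>g m n\<close> with \<open>m < n\<close> along them.\<close>

lemma baire_one_glue_zero_sets:
  fixes G :: "nat \<Rightarrow> 'a set"
  assumes Z: "contractible_space Z" "topspace Z \<noteq> {}"
    and f: "f \<in> topspace S \<rightarrow> topspace Z"
    and G: "\<And>m. zero_set_in S (G m)" and cover: "topspace S \<subseteq> (\<Union>m. G m)"
    and lim: "\<And>m. \<exists>g. (\<forall>n. continuous_map S Z (g n)) \<and>
      (\<forall>p \<in> G m. limitin Z (\<lambda>n. g n p) (f p) sequentially)"
  shows "f \<in> baire_one S Z"
proof -
  obtain g where g: "\<And>m n. continuous_map S Z (g m n)"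
      "\<And>m p. p \<in> G m \<Longrightarrow> limitin Z (\<lambda>n. g m n p) (f p) sequentially"
    using lim by metis
  have "\<exists>u. continuous_map S euclideanreal u \<and> (\<forall>p \<in> topspace S. 0 \<le> u p \<and> u p \<le> 1) \<and>
          G m = {p \<in> topspace S. u p = 0}" for m
    using G by (simp add: zero_set_in_iff)
  then obtain u where u: "\<And>m. continuous_map S euclideanreal (u m)"
      "\<And>m p. p \<in> topspace S \<Longrightarrow> 0 \<le> u m p"
      "\<And>m. G m = {p \<in> topspace S. u m p = 0}"
    by metis
  \<comment> \<open>On the carrier, \<open>c m\<close> vanishes exactly on the union of the
    \<open>G k\<close> with \<open>k < m\<close>; \<open>c 0\<close> is the empty product 1.\<close>
  define c where "c m p = (\<Prod>k<m. u k p)" for m p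
  have c: "continuous_map S euclideanreal (c m)" for m
    unfolding c_def by (intro continuous_intros u) auto
  \<comment> \<open>Increases with \<open>n\<close>. The bound keeps \<open>c m\<close> away from
    zero and so excludes all points of earlier \<open>G k\<close>.\<close>
  define A where "A n m = G m \<inter> {p \<in> topspace S. 1 / real (Suc n) \<le> c m p}" for n m
  have A: "zero_set_in S (A n m)" for n m
    unfolding A_def by (intro zero_set_in_Int G zero_set_in_ge c)
  have disj: "A n k \<inter> A n l = {}" if "k < l" for n k l
  proof -
    have "c l p = 0" if "p \<in> G k" for p
      using that \<open>k < l\<close> u(3) by (auto simp: c_def)
    then show ?thesis
      by (force simp: A_def)
  qed
  have "\<exists>h. continuous_map S Z h \<and> (\<forall>m<n. \<forall>p \<in> A n m. h p = g m n p)" for n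
    using Z A disj g(1) by (intro contractible_glue_finite) auto
  then obtain h where h: "\<And>n. continuous_map S Z (h n)"
      "\<And>n m p. m < n \<Longrightarrow> p \<in> A n m \<Longrightarrow> h n p = g m n p"
    by metis
  have "limitin Z (\<lambda>n. h n p) (f p) sequentially" if p: "p \<in> topspace S" for p
  proof -
    \<comment> \<open>By minimality \<open>c m p\<close> is positive, so \<open>p\<close> lies in
      \<open>A n m\<close> for all large \<open>n\<close>; once also \<open>n > m\<close>, the glued
      map \<open>h n\<close> agrees with \<open>g m n\<close> at \<open>p\<close>.\<close>
    define m where "m = (LEAST m. p \<in> G m)"
    have m: "p \<in> G m"
      unfolding m_def using cover p by (metis LeastI UN_E subsetD)
    have "p \<notin> G k" if "k < m" for k
      using that not_less_Least unfolding m_def by blast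
    then have "c m p > 0"
      unfolding c_def using p u(2,3) by (intro prod_pos) (force simp: less_le)
    then obtain N where N: "1 / real (Suc N) < c m p"
      by (rule nat_approx_posE)
    have "eventually (\<lambda>n. g m n p = h n p) sequentially"
      using eventually_ge_at_top[of N] eventually_gt_at_top[of m]
    proof eventually_elim
      case (elim n)
      have "1 / real (Suc n) \<le> 1 / real (Suc N)"
        using elim(1) by (intro divide_left_mono) auto
      then have "p \<in> A n m"
        using N m p by (auto simp: A_def)
      then show ?case
        using h(2)[of m n p] elim(2) by simp
    qed
    then show ?thesis
      by (rule limitin_transform_eventually) (rule g(2)[OF m])
  qed
  then show ?thesis
    using f h(1) by (auto simp: baire_one_def continuous_maps_def)
qed

text \<open>Favorability of a piece concerns maps on the whole product, so \<open>f\<close> is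
  extended from \<open>G\<close> by a constant. A preimage then consists of a part inside
  \<open>G\<close> and possibly the complement of \<open>G\<close>, which is a co-zero set and hence
  a countable union of zero sets.\<close>

lemma H1_star_restrict:
  assumes f: "f \<in> H1_star S Z" and G: "zero_set_in S G" and T: "T \<subseteq> topspace Z" "f ` G \<subseteq> T" "c \<in> T"
  shows "(\<lambda>p. if p \<in> G then f p else c) \<in> H1_star S (subtopology Z T)"
  unfolding H1_star_def
proof (intro CollectI conjI allI impI)
  show "(\<lambda>p. if p \<in> G then f p else c) \<in> topspace S \<rightarrow> topspace (subtopology Z T)"
    using T by fastforce
next
  fix W assume "openin (subtopology Z T) W"
  then obtain V where V: "openin Z V" "W = V \<inter> T"
    by (auto simp: openin_subtopology)
  have "(countable union_of zero_set_in S) {p \<in> topspace S. f p \<in> V}"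
    using f V(1) by (simp add: H1_star_def)
  then have 1: "(countable union_of zero_set_in S) ({p \<in> topspace S. f p \<in> V} \<inter> G)"
    by (rule countable_union_of_Int) (auto intro: zero_set_in_Int countable_union_of_inc G)
  have "cozero_set_in S (topspace S - G)"
    using G zero_set_in_subset[OF G] by (simp add: cozero_set_in_iff double_diff)
  then have 2: "(countable union_of zero_set_in S) (if c \<in> V then topspace S - G else {})"
    by (simp add: cozero_set_in_countable_union_of_zero_set_in)
  have "{p \<in> topspace S. (if p \<in> G then f p else c) \<in> W} =
      ({p \<in> topspace S. f p \<in> V} \<inter> G) \<union> (if c \<in> V then topspace S - G else {})"
    using T V(2) by auto
  then show "(countable union_of zero_set_in S) {p \<in> topspace S. (if p \<in> G then f p else c) \<in> W}"
    using countable_union_of_Un[OF 1 2] by simp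
qed

lemma baire_one_subtopologyD:
  assumes "f \<in> baire_one S (subtopology Z T)"
  shows "\<exists>g. (\<forall>n. continuous_map S Z (g n)) \<and>
    (\<forall>p \<in> topspace S. limitin Z (\<lambda>n. g n p) (f p) sequentially)"
  using assms by (auto simp: baire_one_def continuous_maps_def continuous_map_in_subtopology limitin_subtopology)

section \<open>Convergence along all selections of indices\<close>

text \<open>Choose at every stage an index whose value misses \<open>V\<close> whenever there is
  one. This selection converges too, so from some stage on there is no such index.\<close>

lemma selections_limit_eventually:
  fixes J :: "nat \<Rightarrow> 'i set"
  assumes sel: "\<And>j. (\<And>n. j n \<in> J n) \<Longrightarrow> limitin Z (\<lambda>n. a n (j n)) l sequentially"
    and ne: "\<And>n. J n \<noteq> {}" and V: "openin Z V" "l \<in> V"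
  shows "\<forall>\<^sub>F n in sequentially. \<forall>i \<in> J n. a n i \<in> V"
proof -
  have "\<exists>i. i \<in> J n \<and> ((\<exists>i' \<in> J n. a n i' \<notin> V) \<longrightarrow> a n i \<notin> V)" for n
    using ne[of n] by blast
  then obtain j where j: "\<And>n. j n \<in> J n" "\<And>n. (\<exists>i' \<in> J n. a n i' \<notin> V) \<longrightarrow> a n (j n) \<notin> V"
    by metis
  have "\<forall>\<^sub>F n in sequentially. a n (j n) \<in> V"
    using sel[OF j(1)] V by (simp add: limitin_def)
  then show ?thesis
    by eventually_elim (use j(2) in blast)
qed

text \<open>Since each \<open>J n\<close> is finite, listing all values \<open>a n i\<close> gives a single convergent sequence.\<close>

lemma absorbing_selections:
  fixes J :: "nat \<Rightarrow> 'i set"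
  assumes abs: "convergent_sequence_absorbing Z Zs"
    and sel: "\<And>j. (\<And>n. j n \<in> J n) \<Longrightarrow> limitin Z (\<lambda>n. a n (j n)) l sequentially"
    and J: "\<And>n. finite (J n)" "\<And>n. J n \<noteq> {}"
    and a: "\<And>n i. i \<in> J n \<Longrightarrow> a n i \<in> topspace Z"
  shows "\<exists>m. \<forall>n. \<forall>i \<in> J n. a n i \<in> Zs m"
proof -
  \<comment> \<open>All pairs of a stage and an admissible index: countable since each
    \<open>J n\<close> is finite, infinite since none is empty. Its enumeration \<open>e\<close>
    turns the values into one sequence \<open>z\<close>.\<close>
  define K where "K = Sigma UNIV J"
  have "countable K"
    unfolding K_def using J(1) by (intro countable_SIGMA) (auto intro: countable_finite)
  moreover have "infinite K"
  proof
    assume "finite K"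
    then have "finite (fst ` K)"
      by simp
    moreover have "fst ` K = UNIV"
      using J(2) by (force simp: K_def image_iff)
    ultimately show False
      by simp
  qed
  ultimately have e: "bij_betw (from_nat_into K) UNIV K"
    by (rule bij_betw_from_nat_into)
  define e where "e = from_nat_into K"
  have eK: "e k \<in> K" for k
    using e unfolding e_def by (auto simp: bij_betw_def)
  define z where "z k = a (fst (e k)) (snd (e k))" for k
  have zr: "range z \<subseteq> topspace Z"
  proof
    fix w assume "w \<in> range z"
    then obtain k where "w = z k"
      by blast
    then show "w \<in> topspace Z"
      using eK[of k] a by (cases "e k") (auto simp: z_def K_def)
  qed
  have "(SOME i. i \<in> J n) \<in> J n" for n
    using J(2)[of n] by (simp add: some_in_eq)
  then have l: "l \<in> topspace Z"
    by (rule limitin_topspace[OF sel])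
  have "limitin Z z l sequentially"
    unfolding limitin_def
  proof (intro conjI l allI impI)
    fix V assume "openin Z V \<and> l \<in> V"
    then have "\<forall>\<^sub>F n in sequentially. \<forall>i \<in> J n. a n i \<in> V"
      using sel J(2) by (intro selections_limit_eventually) auto
    then obtain N where N: "\<And>n i. N \<le> n \<Longrightarrow> i \<in> J n \<Longrightarrow> a n i \<in> V"
      by (auto simp: eventually_sequentially)
    have "finite (Sigma {..<N} J)"
      using J(1) by blast
    then have "finite (e -` Sigma {..<N} J)"
      using e unfolding e_def by (intro finite_vimageI) (auto simp: bij_betw_def)
    \<comment> \<open>Only the finitely many pairs with stage below \<open>N\<close> can have values
      outside \<open>V\<close>, and \<open>e\<close> is injective.\<close>
    moreover have "{k. z k \<notin> V} \<subseteq> e -` Sigma {..<N} J"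
    proof
      fix k assume "k \<in> {k. z k \<notin> V}"
      then show "k \<in> e -` Sigma {..<N} J"
        using eK[of k] N[of "fst (e k)" "snd (e k)"] by (cases "e k") (auto simp: z_def K_def simp flip: not_le)
    qed
    ultimately have "finite {k. z k \<notin> V}"
      by (rule rev_finite_subset)
    then show "\<forall>\<^sub>F k in sequentially. z k \<in> V"
      by (simp add: eventually_cofinite flip: cofinite_eq_sequentially)
  qed
  then obtain m where m: "range z \<subseteq> Zs m"
    using abs zr unfolding convergent_sequence_absorbing_def by blast
  have "a n i \<in> Zs m" if "i \<in> J n" for n i
  proof -
    have "(n, i) \<in> range e"
      using e that by (simp add: bij_betw_def e_def K_def)
    then obtain k where "e k = (n, i)"
      by fastforce
    moreover have "z k \<in> Zs m"
      using m by blast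
    ultimately show ?thesis
      by (simp add: z_def)
  qed
  then show ?thesis
    by blast
qed

section \<open>Approximants given by a locally finite system of co-zero covers\<close>

locale strong_PP_approximation =
  fixes X :: "'a topology" and Y :: "'b topology" and Z :: "'c topology"
    and f :: "'a \<times> 'b \<Rightarrow> 'c"
    and I :: "nat \<Rightarrow> 'i set" and U :: "nat \<Rightarrow> 'i \<Rightarrow> 'a set" and \<xi> :: "nat \<Rightarrow> 'i \<Rightarrow> 'a"
  assumes cover: "\<And>n. locally_finite_cozero_cover X (I n) (U n)"
    and conv: "\<And>x j. x \<in> topspace X \<Longrightarrow> (\<And>n. j n \<in> I n \<and> x \<in> U n (j n)) \<Longrightarrow>
      limitin X (\<lambda>n. \<xi> n (j n)) x sequentially"
    and cont_X: "\<And>y. y \<in> topspace Y \<Longrightarrow> continuous_map X Z (\<lambda>x. f (x, y))"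
    and cont_Y: "\<And>n i. i \<in> I n \<Longrightarrow> continuous_map Y Z (\<lambda>y. f (\<xi> n i, y))"
    and perfect: "perfectly_normal_space Z"
begin

definition active :: "nat \<Rightarrow> 'a \<Rightarrow> 'i set" where
  "active n x = {i \<in> I n. x \<in> U n i}"

lemma finite_active:
  assumes "x \<in> topspace X"
  shows "finite (active n x)"
proof -
  obtain V where V: "x \<in> V" "finite {i \<in> I n. U n i \<inter> V \<noteq> {}}"
    using assms cover[of n] unfolding locally_finite_cozero_cover_def by blast
  have "active n x \<subseteq> {i \<in> I n. U n i \<inter> V \<noteq> {}}"
    using V(1) by (auto simp: active_def)
  then show ?thesis
    using V(2) finite_subset by blast
qed

lemma active_nonempty: "x \<in> topspace X \<Longrightarrow> active n x \<noteq> {}"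
  using cover[of n] by (auto simp: active_def locally_finite_cozero_cover_def)

text \<open>The selected points converge to \<open>x\<close> in \<open>X\<close>, and the continuous
  section of \<open>f\<close> at \<open>y\<close> carries this convergence to
  \<open>Z\<close>.\<close>

lemma limitin_selection:
  assumes "x \<in> topspace X" "y \<in> topspace Y" "\<And>n. j n \<in> active n x"
  shows "limitin Z (\<lambda>n. f (\<xi> n (j n), y)) (f (x, y)) sequentially"
proof -
  have "limitin X (\<lambda>n. \<xi> n (j n)) x sequentially"
    using assms(1,3) by (intro conv) (auto simp: active_def)
  from continuous_map_limit[OF cont_X[OF assms(2)] this] show ?thesis
    by (simp add: o_def)
qed

definition constrained :: "nat \<Rightarrow> 'c set \<Rightarrow> ('a \<times> 'b) set" where
  "constrained n F = {p \<in> topspace (prod_topology X Y). \<forall>i \<in> active n (fst p). f (\<xi> n i, snd p) \<in> F}"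

text \<open>The complement is a locally finite union of co-zero rectangles.\<close>

lemma zero_set_in_constrained:
  assumes F: "closedin Z F"
  shows "zero_set_in (prod_topology X Y) (constrained n F)"
proof -
  have "cozero_set_in Z (topspace Z - F)"
    using perfectly_normal_closedin_zero_set_in[OF perfect F] closedin_subset[OF F]
    by (simp add: cozero_set_in_iff double_diff)
  then have V: "cozero_set_in Y {y \<in> topspace Y. f (\<xi> n i, y) \<in> topspace Z - F}" if "i \<in> I n" for i
    by (rule cozero_set_in_preimage[OF cont_Y[OF that]])
  \<comment> \<open>The points where index \<open>i\<close> violates the constraint. Such a
    rectangle meets \<open>V \<times> topspace Y\<close> only if \<open>U n i\<close> meets
    \<open>V\<close>, so local finiteness passes to the product.\<close>
  define W where "W i = U n i \<times> {y \<in> topspace Y. f (\<xi> n i, y) \<in> topspace Z - F}" for i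
  have "cozero_set_in (prod_topology X Y) (\<Union>i \<in> I n. W i)"
  proof (rule cozero_set_in_locally_finite_UN)
    fix i assume "i \<in> I n"
    then show "cozero_set_in (prod_topology X Y) (W i)"
      using V cover[of n] unfolding W_def
      by (intro cozero_set_in_Times) (auto simp: locally_finite_cozero_cover_def)
  next
    fix p assume "p \<in> topspace (prod_topology X Y)"
    then obtain x y where p: "p = (x, y)" "x \<in> topspace X" "y \<in> topspace Y"
      by auto
    then obtain V where V: "openin X V" "x \<in> V" "finite {i \<in> I n. U n i \<inter> V \<noteq> {}}"
      using cover[of n] unfolding locally_finite_cozero_cover_def by blast
    have "finite {i \<in> I n. W i \<inter> (V \<times> topspace Y) \<noteq> {}}"
      by (rule finite_subset[OF _ V(3)]) (auto simp: W_def)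
    moreover have "openin (prod_topology X Y) (V \<times> topspace Y)"
      using V(1) by (simp add: openin_prod_Times_iff)
    ultimately show "\<exists>V. openin (prod_topology X Y) V \<and> p \<in> V \<and> finite {i \<in> I n. W i \<inter> V \<noteq> {}}"
      using p V(2) by blast
  qed
  moreover have "topspace (prod_topology X Y) - (\<Union>i \<in> I n. W i) = constrained n F"
  proof -
    have "f (\<xi> n i, y) \<in> topspace Z" if "i \<in> I n" "y \<in> topspace Y" for i y
      using continuous_map_funspace[OF cont_Y[OF that(1)]] that(2) by auto
    then show ?thesis
      by (auto simp: constrained_def W_def active_def)
  qed
  ultimately show ?thesis
    by (simp add: cozero_set_in_iff)
qed

text \<open>Any one selection of active indices converges to \<open>f p\<close> and stays in the
  closed set \<open>F\<close> from stage \<open>N\<close> on.\<close>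

lemma constrained_limit:
  assumes F: "closedin Z F" and p: "\<And>n. N \<le> n \<Longrightarrow> p \<in> constrained n F"
  shows "f p \<in> F"
proof -
  have "p \<in> topspace (prod_topology X Y)"
    using p[of N] by (simp add: constrained_def)
  then obtain x y where xy: "p = (x, y)" "x \<in> topspace X" "y \<in> topspace Y"
    by auto
  have "\<exists>i. i \<in> active n x" for n
    using active_nonempty[OF xy(2)] by blast
  then obtain j where j: "\<And>n. j n \<in> active n x"
    by metis
  have "\<forall>\<^sub>F n in sequentially. f (\<xi> n (j n), y) \<in> F"
    using p j xy(1) by (auto simp: eventually_sequentially constrained_def)
  then show ?thesis
    using limitin_closedin[OF limitin_selection[OF xy(2,3) j] F] xy(1) by simp
qed

lemma f_in_topspace: "f \<in> topspace (prod_topology X Y) \<rightarrow> topspace Z"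
  using continuous_map_funspace[OF cont_X] by fastforce

text \<open>An open \<open>V\<close> is a co-zero set \<open>g > 0\<close>, exhausted by closed sets
  \<open>F m\<close>. A point is mapped into \<open>V\<close> iff for some \<open>m\<close> all its
  approximants lie in \<open>F m\<close> from some stage on, and each such tail condition defines a
  zero set.\<close>

lemma f_in_H1_star: "f \<in> H1_star (prod_topology X Y) Z"
  unfolding H1_star_def
proof (intro CollectI conjI allI impI f_in_topspace)
  fix V assume V: "openin Z V"
  have "cozero_set_in Z V"
    using perfectly_normal_closedin_zero_set_in[OF perfect, of "topspace Z - V"] V openin_subset[OF V]
    by (auto simp: cozero_set_in_iff)
  then obtain g where g: "continuous_map Z euclideanreal g" "V = {z \<in> topspace Z. g z > 0}"
    using cozero_set_in_positive by blast
  define F where "F m = {z \<in> topspace Z. g z \<in> {1 / real (Suc m)..}}" for m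
  have F: "closedin Z (F m)" for m
    unfolding F_def by (intro closedin_continuous_map_preimage[OF g(1)]) simp
  have "{p \<in> topspace (prod_topology X Y). f p \<in> V} = (\<Union>m. \<Union>N. \<Inter>n. constrained (N + n) (F m))"
  proof (intro equalityI subsetI)
    fix p assume "p \<in> {p \<in> topspace (prod_topology X Y). f p \<in> V}"
    then obtain x y where xy: "p = (x, y)" "x \<in> topspace X" "y \<in> topspace Y" "f (x, y) \<in> V"
      by auto
    then have "0 < g (f (x, y))"
      by (simp add: g(2))
    then obtain m where m: "1 / real (Suc m) < g (f (x, y))"
      by (rule nat_approx_posE)
    \<comment> \<open>The strict inequality gives an open neighbourhood of \<open>f (x, y)\<close>
      inside \<open>F m\<close>, as convergence along all selections needs an open set.\<close>
    define O' where "O' = {z \<in> topspace Z. g z \<in> {1 / real (Suc m)<..}}"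
    have "openin Z O'"
      unfolding O'_def by (intro openin_continuous_map_preimage[OF g(1)]) simp
    moreover have "f (x, y) \<in> O'"
      using xy(4) m by (simp add: O'_def g(2))
    ultimately have "\<forall>\<^sub>F n in sequentially. \<forall>i \<in> active n x. f (\<xi> n i, y) \<in> O'"
      using selections_limit_eventually[where J = "\<lambda>n. active n x" and a = "\<lambda>n i. f (\<xi> n i, y)"]
        limitin_selection[OF xy(2,3)] active_nonempty[OF xy(2)] by blast
    moreover have "O' \<subseteq> F m"
      by (auto simp: O'_def F_def)
    ultimately obtain N where "\<And>n. N \<le> n \<Longrightarrow> \<forall>i \<in> active n x. f (\<xi> n i, y) \<in> F m"
      unfolding eventually_sequentially by blast
    then have "p \<in> constrained (N + n) (F m)" for n
      using xy by (simp add: constrained_def)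
    then show "p \<in> (\<Union>m. \<Union>N. \<Inter>n. constrained (N + n) (F m))"
      by blast
  next
    fix p assume "p \<in> (\<Union>m. \<Union>N. \<Inter>n. constrained (N + n) (F m))"
    then obtain m N where mN: "\<And>n. p \<in> constrained (N + n) (F m)"
      by blast
    then have "p \<in> constrained n (F m)" if "N \<le> n" for n
      using that by (metis le_iff_add)
    then have "f p \<in> F m"
      by (rule constrained_limit[OF F])
    moreover have "0 < 1 / real (Suc m)"
      by simp
    ultimately have "f p \<in> V"
      unfolding F_def g(2) mem_Collect_eq atLeast_iff by linarith
    moreover have "p \<in> topspace (prod_topology X Y)"
      using mN[of 0] by (simp add: constrained_def)
    ultimately show "p \<in> {p \<in> topspace (prod_topology X Y). f p \<in> V}"
      by simp
  qed
  moreover have "(countable union_of zero_set_in (prod_topology X Y))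
      (\<Union>m. \<Union>N. \<Inter>n. constrained (N + n) (F m))"
    by (intro countable_union_of_UN countable_union_of_inc zero_set_in_INT zero_set_in_constrained F) simp_all
  ultimately show "(countable union_of zero_set_in (prod_topology X Y))
      {p \<in> topspace (prod_topology X Y). f p \<in> V}"
    by simp
qed

lemma f_in_baire_one:
  assumes Z: "contractible_space Z" "topspace Z \<noteq> {}"
    and Zs: "\<And>m. closedin Z (Zs m)" and abs: "convergent_sequence_absorbing Z Zs"
    and fav: "\<And>m. weakly_B1_favorable (subtopology Z (Zs m)) (prod_topology X Y)"
  shows "f \<in> baire_one (prod_topology X Y) Z"
proof -
  \<comment> \<open>All stages are constrained, not only a tail: absorption captures the entire
    sequence of approximants in one \<open>Zs m\<close>.\<close>
  define G where "G m = (\<Inter>n. constrained n (Zs m))" for m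
  have G: "zero_set_in (prod_topology X Y) (G m)" for m
    unfolding G_def by (intro zero_set_in_INT zero_set_in_constrained Zs)
  have fG: "f ` G m \<subseteq> Zs m" for m
    using constrained_limit[OF Zs, of 0] by (auto simp: G_def)
  have cov: "topspace (prod_topology X Y) \<subseteq> (\<Union>m. G m)"
  proof
    fix p assume "p \<in> topspace (prod_topology X Y)"
    then obtain x y where xy: "p = (x, y)" "x \<in> topspace X" "y \<in> topspace Y"
      by auto
    have "\<exists>m. \<forall>n. \<forall>i \<in> active n x. f (\<xi> n i, y) \<in> Zs m"
    proof (rule absorbing_selections[OF abs])
      show "limitin Z (\<lambda>n. f (\<xi> n (j n), y)) (f (x, y)) sequentially"
        if "\<And>n. j n \<in> active n x" for j
        using limitin_selection[OF xy(2,3) that] .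
      show "f (\<xi> n i, y) \<in> topspace Z" if "i \<in> active n x" for n i
        using continuous_map_funspace[OF cont_Y, of i n] that xy(3) by (auto simp: active_def)
    qed (use finite_active active_nonempty xy(2) in auto)
    then show "p \<in> (\<Union>m. G m)"
      using xy by (simp add: G_def constrained_def)
  qed
  have lim: "\<exists>g. (\<forall>n. continuous_map (prod_topology X Y) Z (g n)) \<and>
      (\<forall>p \<in> G m. limitin Z (\<lambda>n. g n p) (f p) sequentially)" for m
  \<comment> \<open>An empty piece offers no constant \<open>c\<close> for the extension, but then
    \<open>G m\<close> is empty as well and any continuous maps will do.\<close>
  proof (cases "Zs m = {}")
    case True
    then have "G m = {}"
      using fG[of m] by simp
    moreover obtain z where "z \<in> topspace Z"
      using Z(2) by blast
    ultimately show ?thesis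
      by (intro exI[of _ "\<lambda>_ _. z"]) simp
  next
    case False
    then obtain c where c: "c \<in> Zs m"
      by blast
    let ?h = "\<lambda>p. if p \<in> G m then f p else c"
    have "?h \<in> H1_star (prod_topology X Y) (subtopology Z (Zs m))"
      using f_in_H1_star G closedin_subset[OF Zs] fG c by (rule H1_star_restrict)
    then have "?h \<in> baire_one (prod_topology X Y) (subtopology Z (Zs m))"
      using fav[of m] by (auto simp: weakly_B1_favorable_def)
    then obtain g where "\<forall>n. continuous_map (prod_topology X Y) Z (g n)"
        "\<forall>p \<in> topspace (prod_topology X Y). limitin Z (\<lambda>n. g n p) (?h p) sequentially"
      using baire_one_subtopologyD by blast
    moreover have "limitin Z (\<lambda>n. g n p) (f p) sequentially" if "p \<in> G m" for p
      using bspec[OF calculation(2), of p] that zero_set_in_subset[OF G] by auto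
    ultimately show ?thesis
      by blast
  qed
  show ?thesis
    by (rule baire_one_glue_zero_sets[OF Z f_in_topspace G cov lim])
qed

end

text \<open>The library's \<open>contractible_space\<close> also holds for the empty space; the
  condition \<open>topspace Z \<noteq> {}\<close> supplies the point to which \<open>Z\<close>
  contracts.\<close>

theorem theorem5p5:
  fixes X :: "'a topology" and Y :: "'b topology" and Z :: "'c topology"
    and Zs :: "nat \<Rightarrow> 'c set"
  assumes "strong_PP_space X"
    and "topspace Z \<noteq> {}" and "contractible_space Z"
    and "perfectly_normal_space Z"
    and "\<And>n. closedin Z (Zs n)" and "(\<Union>n. Zs n) = topspace Z"
    and "convergent_sequence_absorbing Z Zs"
    and "\<And>n. weakly_B1_favorable (subtopology Z (Zs n)) (prod_topology X Y)"
  shows "vert_nearly_sep_continuous X Y Z \<subseteq> baire_one (prod_topology X Y) Z"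
proof
  fix f assume f: "f \<in> vert_nearly_sep_continuous X Y Z"
  then obtain D where D: "dense_in X D" "\<And>x. x \<in> D \<Longrightarrow> continuous_map Y Z (\<lambda>y. f (x, y))"
    by (auto simp: vert_nearly_sep_continuous_def continuous_maps_def)
  obtain I :: "nat \<Rightarrow> ('a set \<times> 'a) set" and U \<xi> where PP: "strong_PP_system X D I U \<xi>"
    using assms(1) D(1) unfolding strong_PP_space_def by blast
  \<comment> \<open>The dense set \<open>D\<close> enters through \<open>cont_Y\<close>: the points
    \<open>\<xi> n i\<close> lie in \<open>D\<close>, where the sections of \<open>f\<close> on
    \<open>Y\<close> are continuous.\<close>
  interpret strong_PP_approximation X Y Z f I U \<xi>
  proof
    show "continuous_map X Z (\<lambda>x. f (x, y))" if "y \<in> topspace Y" for y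
      using f that by (auto simp: vert_nearly_sep_continuous_def continuous_maps_def)
  qed (use PP D(2) assms(4) in \<open>auto simp: strong_PP_system_def\<close>)
  show "f \<in> baire_one (prod_topology X Y) Z"
    using assms(3,2,5,7,8) by (rule f_in_baire_one)
qed

end
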